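(* There exists $n_0$ such that for every integer $n \ge n_0$ the following holds: for any (deterministic, adaptive) strategy of the codebreaker in the Permutation Variant of Mastermind on $[n]=\{1,\dots,n\}$, the codebreaker must use at least $n - \log\log n$ guesses to determine the hidden permutation $H$ in the worst case. That is, $f(n) \ge n - \log\log n$ for all sufficiently large $n$.
   Context: Permutation Variant of Mastermind: the codemaker fixes a hidden permutation $H=(h_1,\dots,h_n)$ of $[n]$. In each turn $t=1,2,\dots$ the codebreaker submits a guess $Q_t=(q_1,\dots,q_n)$, which must also be a permutation of $[n]$, and receives the black-peg response $b(Q_t,H)=|\{i\in\{1,\dots,n\} : q_i=h_i\}|$. The game is adaptive: $Q_t$ may depend on the responses to $Q_1,\dots,Q_{t-1}$. A deterministic strategy is a rule which specifies each guess $Q_t$ as a function of the previous guesses and the responses received. For a fixed strategy and hidden permutation $H$, let $S_t$ be the set of permutations $h$ of $[n]$ with $b(Q_i,h)=b(Q_i,H)$ for all $1\le i\le t$ (with $S_0$ the set of all permutations of $[n]$). The codebreaker has determined $H$ after $t$ guesses exactly when $|S_t|=1$. The number $f(n)$ is the smallest integer $m$ for which there is a deterministic strategy that, for every hidden permutation $H$, has determined $H$ after at most $m$ guesses. Here $\log$ denotes the natural logarithm. *)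

theory Defs
  imports Complex_Main "HOL-Combinatorics.Permutations"
begin

text \<open>
  A permutation of \<open>[n]\<close> is a function \<open>p :: nat \<Rightarrow> nat\<close> with \<open>p permutes {1..n}\<close>; as it is the
  identity outside of \<open>{1..n}\<close>, permutations of \<open>[n]\<close> correspond one-to-one to such functions.
\<close>

definition black_pegs :: "nat \<Rightarrow> (nat \<Rightarrow> nat) \<Rightarrow> (nat \<Rightarrow> nat) \<Rightarrow> nat" where
  "black_pegs n q h = card {i \<in> {1..n}. q i = h i}"

text \<open>
  A strategy maps the list of previous rounds (guess, response), oldest round first, to the next
  guess. It has to produce a legal guess on every such list; what it does on lists that
  never arise in play is immaterial.
\<close>

type_synonym strategy = "((nat \<Rightarrow> nat) \<times> nat) list \<Rightarrow> (nat \<Rightarrow> nat)"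

definition valid_strategy :: "nat \<Rightarrow> strategy \<Rightarrow> bool" where
  "valid_strategy n \<sigma> \<longleftrightarrow> (\<forall>rounds. \<sigma> rounds permutes {1..n})"

primrec history :: "nat \<Rightarrow> strategy \<Rightarrow> (nat \<Rightarrow> nat) \<Rightarrow> nat \<Rightarrow> ((nat \<Rightarrow> nat) \<times> nat) list" where
  "history n \<sigma> H 0 = []"
| "history n \<sigma> H (Suc t) =
     (let q = \<sigma> (history n \<sigma> H t) in history n \<sigma> H t @ [(q, black_pegs n q H)])"

text \<open>Guesses are numbered from 1; \<open>t = 0\<close> is not used.\<close>

definition guess :: "nat \<Rightarrow> strategy \<Rightarrow> (nat \<Rightarrow> nat) \<Rightarrow> nat \<Rightarrow> (nat \<Rightarrow> nat)" where
  "guess n \<sigma> H t = \<sigma> (history n \<sigma> H (t - 1))"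

definition consistent :: "nat \<Rightarrow> strategy \<Rightarrow> (nat \<Rightarrow> nat) \<Rightarrow> nat \<Rightarrow> (nat \<Rightarrow> nat) set" where
  "consistent n \<sigma> H t =
     {h. h permutes {1..n} \<and>
         (\<forall>i\<in>{1..t}. black_pegs n (guess n \<sigma> H i) h = black_pegs n (guess n \<sigma> H i) H)}"

definition determined :: "nat \<Rightarrow> strategy \<Rightarrow> (nat \<Rightarrow> nat) \<Rightarrow> nat \<Rightarrow> bool" where
  "determined n \<sigma> H t \<longleftrightarrow> card (consistent n \<sigma> H t) = 1"

definition determines_within :: "nat \<Rightarrow> strategy \<Rightarrow> nat \<Rightarrow> bool" where
  "determines_within n \<sigma> m \<longleftrightarrow> (\<forall>H. H permutes {1..n} \<longrightarrow> (\<exists>t\<le>m. determined n \<sigma> H t))"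

definition mastermind_number :: "nat \<Rightarrow> nat" where
  "mastermind_number n = (LEAST m. \<exists>\<sigma>. valid_strategy n \<sigma> \<and> determines_within n \<sigma> m)"

text \<open>The minimum is over a nonempty set: guessing all permutations in turn succeeds.\<close>

lemma black_pegs_eq_imp_eq:
  assumes "h permutes {1..n}" "H permutes {1..n}" "black_pegs n H h = black_pegs n H H"
  shows "h = H"
proof (rule ext)
  have "card {i \<in> {1..n}. H i = h i} = card {1..n}"
    using assms(3) unfolding black_pegs_def by (simp only: simp_thms Collect_mem_eq)
  then have "{i \<in> {1..n}. H i = h i} = {1..n}"
    using card_subset_eq[of "{1..n}" "{i \<in> {1..n}. H i = h i}"] by blast
  then have "H i = h i" if "i \<in> {1..n}" for i
    using that by blast
  then show "h i = H i" for i
    using permutes_not_in[OF assms(1)] permutes_not_in[OF assms(2)] by metis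
qed

lemma length_history: "length (history n \<sigma> H t) = t"
  by (induction t) (simp_all add: Let_def)

lemma ex_determines_within: "\<exists>m \<sigma>. valid_strategy n \<sigma> \<and> determines_within n \<sigma> m"
proof -
  obtain ps where ps: "set ps = {p. p permutes {1..n}}"
    using finite_list[OF finite_permutations[of "{1..n}"]] by auto
  define \<sigma> :: strategy
    where "\<sigma> = (\<lambda>rounds. if length rounds < length ps then ps ! length rounds else id)"
  have "valid_strategy n \<sigma>"
    using ps nth_mem[of _ ps] by (auto simp: valid_strategy_def \<sigma>_def permutes_id)
  moreover have "determined n \<sigma> H (length ps)" if H: "H permutes {1..n}" for H
  proof -
    obtain k where k: "k < length ps" "ps ! k = H"
      using H ps by (metis in_set_conv_nth mem_Collect_eq)
    have "guess n \<sigma> H (Suc k) = H"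
      using k by (simp add: guess_def \<sigma>_def length_history)
    moreover have "Suc k \<in> {1..length ps}"
      using k by simp
    ultimately have "h = H" if "h \<in> consistent n \<sigma> H (length ps)" for h
      using that H black_pegs_eq_imp_eq[of h n H] unfolding consistent_def
      by (smt (verit, best) mem_Collect_eq)
    moreover have "H \<in> consistent n \<sigma> H (length ps)"
      using H by (simp add: consistent_def)
    ultimately have "consistent n \<sigma> H (length ps) = {H}"
      by blast
    then show ?thesis
      by (simp add: determined_def)
  qed
  ultimately show ?thesis
    unfolding determines_within_def by blast
qed

end

theory Submission imports Defs begin

text \<open>
  The codemaker answers greedily. Only \<open>n! / k!\<close> permutations agree with a guess in at least
  \<open>k\<close> places, so all but \<open>n! / k!\<close> of the remaining candidates give one of the \<open>k\<close> responses
  \<open>0, \<dots>, k - 1\<close>, and some response leaves at least \<open>(|S\<^sub>t| - n! / k!) / k\<close> of them. Taking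
  \<open>k = t + m + 1\<close> in round \<open>t + 1\<close>, induction gives
  \<open>|S\<^sub>t| \<ge> n! m! / (t + m)! (1 - (1 / m!) \<Sum>\<^sub>i\<^sub><\<^sub>t 1 / (m + i + 1))\<close>. The last factor is at least
  \<open>1 / 2\<close> once \<open>m! \<ge> 2 ln n\<close>, which holds already for \<open>m = \<lfloor>ln (ln n)\<rfloor> - 1\<close>; then \<open>|S\<^sub>t| > 1\<close> as
  long as \<open>t + m \<le> n - 2\<close>.
\<close>

section \<open>Permutations agreeing with a guess\<close>

text \<open>Composing with \<open>inv q\<close> turns agreement with \<open>q\<close> on
  \<open>A\<close> into fixing \<open>A\<close> pointwise, so these \<open>h\<close> inject into the
  permutations of \<open>S - A\<close>.\<close>

lemma card_permutes_agree_on: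
  assumes "finite S" "q permutes S" "A \<subseteq> S"
  shows "card {h. h permutes S \<and> (\<forall>i\<in>A. q i = h i)} \<le> fact (card S - card A)"
proof -
  let ?F = "{h. h permutes S \<and> (\<forall>i\<in>A. q i = h i)}"
  have "inj_on (\<lambda>h. inv q \<circ> h) ?F"
    using fun.inj_map[OF permutes_inj[OF permutes_inv[OF assms(2)]]] by (rule inj_on_subset) simp
  moreover have "(\<lambda>h. inv q \<circ> h) ` ?F \<subseteq> {p. p permutes (S - A)}"
  proof clarify
    fix h assume h: "h permutes S" "\<forall>i\<in>A. q i = h i"
    have "inv q \<circ> h permutes S"
      using h(1) assms(2) by (simp add: permutes_compose permutes_inv)
    moreover have "(inv q \<circ> h) i = i" if "i \<in> A" for i
      using h(2) that assms(2) by (metis comp_apply permutes_inverses(2))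
    ultimately show "inv q \<circ> h permutes (S - A)"
      by (rule permutes_superset) auto
  qed
  moreover have "finite {p. p permutes (S - A)}"
    using assms(1) by (simp add: finite_permutations)
  ultimately have "card ?F \<le> card {p. p permutes (S - A)}"
    by (rule card_inj_on_le)
  also have "\<dots> = fact (card S - card A)"
    using assms finite_subset[OF assms(3,1)] by (simp add: card_permutations card_Diff_subset)
  finally show ?thesis .
qed

text \<open>Union bound over the \<open>k\<close>-sets of positions where guess and secret agree:
  \<open>(n choose k) * fact (n - k)\<close> equals \<open>fact n / fact k\<close>. For
  \<open>k > n\<close> the set is empty.\<close>

lemma card_black_pegs_ge:
  assumes q: "q permutes {1..n}"
  shows "real (card {h. h permutes {1..n} \<and> k \<le> black_pegs n q h}) \<le> fact n / fact k"
proof (cases "k \<le> n")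
  case True
  let ?I = "{A. A \<subseteq> {1..n} \<and> card A = k}"
  let ?F = "\<lambda>A. {h. h permutes {1..n} \<and> (\<forall>i\<in>A. q i = h i)}"
  have "{h. h permutes {1..n} \<and> k \<le> black_pegs n q h} \<subseteq> (\<Union>A\<in>?I. ?F A)"
  proof clarify
    fix h assume h: "h permutes {1..n}" "k \<le> black_pegs n q h"
    then obtain A where "A \<subseteq> {i \<in> {1..n}. q i = h i}" "card A = k"
      unfolding black_pegs_def by (meson obtain_subset_with_card_n)
    then show "h \<in> (\<Union>A\<in>?I. ?F A)"
      using h(1) by blast
  qed
  moreover have "finite (\<Union>A\<in>?I. ?F A)"
    by (rule finite_subset[OF _ finite_permutations[of "{1..n}"]]) auto
  ultimately have "card {h. h permutes {1..n} \<and> k \<le> black_pegs n q h} \<le> card (\<Union>A\<in>?I. ?F A)"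
    by (rule card_mono[rotated])
  also have "\<dots> \<le> (\<Sum>A\<in>?I. card (?F A))"
    by (rule card_UN_le) simp
  also have "\<dots> \<le> (\<Sum>A\<in>?I. fact (n - k))"
    using card_permutes_agree_on[OF _ q] by (intro sum_mono) fastforce
  also have "\<dots> = (n choose k) * fact (n - k)"
    using n_subsets[of "{1..n}" k] by simp
  finally have "real (card {h. h permutes {1..n} \<and> k \<le> black_pegs n q h})
      \<le> real ((n choose k) * fact (n - k))"
    by (simp only: of_nat_le_iff)
  also have "\<dots> = fact n / fact k"
    using binomial_fact[OF True, where 'a = real] by simp
  finally show ?thesis .
next
  case False
  have "black_pegs n q h \<le> n" for h
    using card_mono[of "{1..n}" "{i \<in> {1..n}. q i = h i}"] unfolding black_pegs_def by fastforce
  then have "{h. h permutes {1..n} \<and> k \<le> black_pegs n q h} = {}"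
    using False by (metis (no_types, lifting) empty_Collect_eq order_trans)
  then show ?thesis by (simp only: card.empty) simp
qed

section \<open>Candidate sets as classes of secrets\<close>

lemma finite_consistent: "finite (consistent n \<sigma> H t)"
  by (rule finite_subset[OF _ finite_permutations[of "{1..n}"]]) (auto simp: consistent_def)

lemma consistent_antimono: "s \<le> t \<Longrightarrow> consistent n \<sigma> H t \<subseteq> consistent n \<sigma> H s"
  by (auto simp: consistent_def)

text \<open>The strategy is deterministic and sees only responses, so secrets that have answered
  alike so far have produced the same play.\<close>

lemma history_consistent:
  "H' \<in> consistent n \<sigma> H t \<Longrightarrow> history n \<sigma> H' t = history n \<sigma> H t"
proof (induction t)
  case (Suc t)
  then have "history n \<sigma> H' t = history n \<sigma> H t"
    using consistent_antimono[of t "Suc t"] by auto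
  moreover have "black_pegs n (guess n \<sigma> H (Suc t)) H' = black_pegs n (guess n \<sigma> H (Suc t)) H"
    using Suc.prems by (simp add: consistent_def)
  ultimately show ?case
    by (simp add: guess_def Let_def)
qed simp

lemma consistent_Suc:
  "consistent n \<sigma> H (Suc t) = {h \<in> consistent n \<sigma> H t.
     black_pegs n (guess n \<sigma> H (Suc t)) h = black_pegs n (guess n \<sigma> H (Suc t)) H}"
  by (auto simp: consistent_def atLeastAtMostSuc_conv)

text \<open>Both secrets meet the same guesses, so both define the same class. The codemaker may
  thus move to any remaining candidate without altering the past.\<close>

lemma consistent_cong:
  assumes "H' \<in> consistent n \<sigma> H t"
  shows "consistent n \<sigma> H' t = consistent n \<sigma> H t"
proof -
  have "guess n \<sigma> H' i = guess n \<sigma> H i" if "i \<in> {1..t}" for i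
  proof -
    \<comment> \<open>Guess \<open>i\<close> is computed from the first \<open>i - 1\<close> rounds
      only.\<close>
    have "H' \<in> consistent n \<sigma> H (i - 1)"
      using assms that consistent_antimono[of "i - 1" t n \<sigma> H]
      by (metis atLeastAtMost_iff diff_le_self le_trans subsetD)
    then show ?thesis
      by (simp add: guess_def history_consistent)
  qed
  then show ?thesis
    using assms by (auto simp: consistent_def)
qed

section \<open>The greedy codemaker\<close>

text \<open>Pigeonhole on the responses below \<open>k\<close>. The codemaker's choice of a response
  is expressed by passing to a secret \<open>H'\<close> that gives it.\<close>

lemma ex_large_response:
  assumes valid: "valid_strategy n \<sigma>" and H: "H permutes {1..n}" and k: "k > 0"
  shows "\<exists>H'. H' permutes {1..n} \<and>
    (real (card (consistent n \<sigma> H t)) - fact n / fact k) / real k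
      \<le> real (card (consistent n \<sigma> H' (Suc t)))"
proof (rule ccontr)
  define r where "r = (real (card (consistent n \<sigma> H t)) - fact n / fact k) / real k"
  assume "\<not> ?thesis"
  then have less: "real (card (consistent n \<sigma> H' (Suc t))) < r" if "H' permutes {1..n}" for H'
    using that not_le unfolding r_def by blast
  define q where "q = guess n \<sigma> H (Suc t)"
  have q: "q permutes {1..n}"
    using valid by (simp add: q_def guess_def valid_strategy_def)
  define S where "S = (\<lambda>j. {h \<in> consistent n \<sigma> H t. black_pegs n q h = j})"
  have S_less: "real (card (S j)) < r" for j
  \<comment> \<open>An empty class is no exception: \<open>H\<close> is itself a legal secret, so
    \<open>less\<close> makes \<open>r\<close> positive.\<close>
  proof (cases "S j = {}")
    case True
    then show ?thesis
      using less[OF H] of_nat_0_le_iff[of "card (consistent n \<sigma> H (Suc t))"]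
      by (metis card.empty le_less_trans of_nat_0)
  next
    case False
    then obtain H' where H': "H' \<in> consistent n \<sigma> H t" "black_pegs n q H' = j"
      by (auto simp: S_def)
    have "guess n \<sigma> H' (Suc t) = q"
      using history_consistent[OF H'(1)] by (simp add: q_def guess_def)
    then have "consistent n \<sigma> H' (Suc t) = S j"
      using H' by (simp add: consistent_Suc consistent_cong S_def)
    then show ?thesis
      using less[of H'] H'(1) by (simp add: consistent_def)
  qed
  define B where "B = {h. h permutes {1..n} \<and> k \<le> black_pegs n q h}"
  have "finite B"
    by (rule finite_subset[OF _ finite_permutations[of "{1..n}"]]) (auto simp: B_def)
  have "consistent n \<sigma> H t \<subseteq> (\<Union>j<k. S j) \<union> B"
    by (auto simp: S_def B_def consistent_def not_le)
  moreover have "finite (\<Union>j<k. S j)"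
    by (simp add: S_def finite_consistent)
  ultimately have "card (consistent n \<sigma> H t) \<le> card ((\<Union>j<k. S j) \<union> B)"
    using \<open>finite B\<close> by (intro card_mono) auto
  also have "\<dots> \<le> card (\<Union>j<k. S j) + card B"
    by (rule card_Un_le)
  also have "card (\<Union>j<k. S j) \<le> (\<Sum>j<k. card (S j))"
    by (rule card_UN_le) simp
  finally have "real (card (consistent n \<sigma> H t)) \<le> (\<Sum>j<k. real (card (S j))) + real (card B)"
    by (simp flip: of_nat_sum of_nat_add)
  also have "(\<Sum>j<k. real (card (S j))) < (\<Sum>j<k. r)"
    using k S_less by (intro sum_strict_mono) auto
  also have "real (card B) \<le> fact n / fact k"
    unfolding B_def by (rule card_black_pegs_ge[OF q])
  finally have "real (card (consistent n \<sigma> H t)) < real k * r + fact n / fact k"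
    by simp
  then show False
    using k by (simp add: r_def)
qed

lemma ex_large_consistent:
  assumes "valid_strategy n \<sigma>"
  shows "\<exists>H. H permutes {1..n} \<and>
    fact n * fact m / fact (t + m) * (1 - (\<Sum>i<t. 1 / real (m + i + 1)) / fact m)
      \<le> real (card (consistent n \<sigma> H t))"
proof (induction t)
  case 0
  have "consistent n \<sigma> id 0 = {p. p permutes {1..n}}"
    by (simp add: consistent_def)
  then have "card (consistent n \<sigma> id 0) = fact n"
    by (simp add: card_permutations)
  then show ?case
    by (intro exI[of _ id] conjI permutes_id) (simp add: id_def)
next
  case (Suc t)
  define u where "u = (\<lambda>t. 1 - (\<Sum>i<t. 1 / real (m + i + 1)) / fact m)"
  obtain H where H: "H permutes {1..n}"
    and le: "fact n * fact m / fact (t + m) * u t \<le> real (card (consistent n \<sigma> H t))"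
    using Suc.IH unfolding u_def by blast
  \<comment> \<open>With this \<open>k\<close>, division by \<open>k\<close> turns
    \<open>fact (t + m)\<close> into \<open>fact k\<close>, and the loss
    \<open>fact n / fact k / k\<close> is \<open>fact n * fact m / fact k\<close> times
    \<open>1 / (k * fact m)\<close>, exactly the drop of \<open>u\<close>.\<close>
  define k where "k = t + m + 1"
  have "k > 0" by (simp add: k_def)
  obtain H' where H': "H' permutes {1..n}"
    and le': "(real (card (consistent n \<sigma> H t)) - fact n / fact k) / real k
       \<le> real (card (consistent n \<sigma> H' (Suc t)))"
    using ex_large_response[OF assms H \<open>k > 0\<close>] by blast
  have fact_k: "fact k = real k * fact (t + m)"
    by (simp add: k_def)
  have u_Suc: "u (Suc t) = u t - 1 / (real k * fact m)"
    by (simp add: u_def k_def add_divide_distrib add_ac)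
  have "fact n * fact m / fact (Suc t + m) * u (Suc t)
      = fact n * fact m / fact k * u (Suc t)"
    by (simp add: k_def)
  also have "\<dots> = (fact n * fact m / fact (t + m) * u t - fact n / fact k) / real k"
    using \<open>k > 0\<close> unfolding u_Suc fact_k by (simp add: field_simps)
  also have "\<dots> \<le> (real (card (consistent n \<sigma> H t)) - fact n / fact k) / real k"
    using le by (intro divide_right_mono) auto
  finally show ?case
    using H' le' unfolding u_def by (meson order_trans)
qed

section \<open>Estimates for the correction factor\<close>

text \<open>Each summand is at most \<open>ln (m + i + 1) - ln (m + i)\<close>; these telescope, and
  \<open>m > 0\<close> makes the initial \<open>ln m\<close> nonnegative.\<close>

lemma sum_inverse_le_ln:
  assumes "m > 0"
  shows "(\<Sum>i<t. 1 / real (m + i + 1)) \<le> ln (real (m + t))"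
proof (induction t)
  case 0
  show ?case using assms by simp
next
  case (Suc t)
  have "ln (real (m + t)) - ln (real (m + t + 1)) \<le> (real (m + t) - real (m + t + 1)) / real (m + t + 1)"
    using assms by (intro ln_diff_le) auto
  then show ?case
    using Suc.IH by (simp add: add_ac)
qed

text \<open>The terms of the exponential series tend to 0. The shift by 2 serves a later
  \<open>m\<close> with \<open>ln (ln n) \<le> m + 2\<close>, for which
  \<open>2 * ln n \<le> fact m\<close> follows.\<close>

lemma eventually_exp_le_fact: "\<forall>\<^sub>F m in sequentially. 2 * exp (real m + 2) \<le> (fact m :: real)"
proof -
  have "(\<lambda>m. inverse (fact m) * exp 1 ^ m :: real) \<longlonglongrightarrow> 0"
    by (rule summable_LIMSEQ_zero[OF summable_exp])
  then have "\<forall>\<^sub>F m in sequentially. inverse (fact m) * exp 1 ^ m < (1 / (2 * exp 2) :: real)"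
    by (rule order_tendstoD) simp
  then show ?thesis
  proof eventually_elim
    case (elim m)
    have "exp (real m) = exp 1 ^ m"
      using exp_of_nat_mult[of m "1 :: real"] by simp
    with elim show ?case
      by (simp add: exp_add field_simps)
  qed
qed

section \<open>Lower bound on the number of guesses\<close>

text \<open>The quotient \<open>fact n / fact (t + m)\<close> retains at least the factors
  \<open>n\<close> and \<open>n - 1\<close>, so it exceeds 2; the correction factor costs at most
  one half.\<close>

lemma ex_undetermined:
  assumes valid: "valid_strategy n \<sigma>" and "m > 0" "t + m + 2 \<le> n" "2 * ln (real n) \<le> fact m"
  shows "\<exists>H. H permutes {1..n} \<and> (\<forall>s\<le>t. \<not> determined n \<sigma> H s)"
proof -
  obtain H where H: "H permutes {1..n}" and
    le: "fact n * fact m / fact (t + m) * (1 - (\<Sum>i<t. 1 / real (m + i + 1)) / fact m)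
      \<le> real (card (consistent n \<sigma> H t))"
    using ex_large_consistent[OF valid] by blast
  have "(\<Sum>i<t. 1 / real (m + i + 1)) \<le> ln (real (m + t))"
    using \<open>m > 0\<close> by (rule sum_inverse_le_ln)
  also have "\<dots> \<le> ln (real n)"
    using assms by simp
  also have "\<dots> \<le> fact m / 2"
    using assms by simp
  finally have "1 - (\<Sum>i<t. 1 / real (m + i + 1)) / fact m \<ge> 1 / 2"
    by (simp add: field_simps)
  moreover have "fact n * fact m / fact (t + m) > (2 :: real)"
  proof -
    obtain l where l: "n = Suc (Suc l)"
      using assms by (metis add_2_eq_Suc' le_Suc_ex add.commute add_Suc_right)
    have "fact (t + m) \<le> (fact l :: real)"
      using assms l by (intro fact_mono) simp
    \<comment> \<open>\<open>m > 0\<close> forces \<open>l \<ge> 1\<close>, so both factors compare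
      strictly.\<close>
    moreover have "2 * 1 < real (Suc (Suc l)) * real (Suc l)"
      using assms l by (intro mult_strict_mono') auto
    ultimately have "2 * fact (t + m) < real (Suc (Suc l)) * real (Suc l) * (fact l :: real)"
      by (intro mult_less_le_imp_less) auto
    also have "\<dots> = fact n"
      by (simp only: l fact_Suc mult.assoc)
    also have "\<dots> \<le> fact n * fact m"
      by (simp add: fact_ge_1)
    finally show ?thesis
      by (simp add: field_simps)
  qed
  ultimately have "2 * (1 / 2) < fact n * fact m / fact (t + m) * (1 - (\<Sum>i<t. 1 / real (m + i + 1)) / fact m)"
    by (intro mult_less_le_imp_less) auto
  with le have "real (card (consistent n \<sigma> H t)) > 1"
    by linarith
  then have "card (consistent n \<sigma> H t) > 1"
    by simp
  \<comment> \<open>Candidate sets only shrink, so earlier rounds are undetermined too.\<close>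
  then have "card (consistent n \<sigma> H s) > 1" if "s \<le> t" for s
    using card_mono[OF finite_consistent consistent_antimono[OF that]] by (meson less_le_trans)
  then show ?thesis
    using H unfolding determined_def by fastforce
qed

theorem theorem1:
  "\<exists>n\<^sub>0. \<forall>n\<ge>n\<^sub>0.
     (\<forall>\<sigma>. valid_strategy n \<sigma> \<longrightarrow>
        (\<exists>H. H permutes {1..n} \<and>
             (\<forall>t. determined n \<sigma> H t \<longrightarrow> real t \<ge> real n - ln (ln (real n))))) \<and>
     real (mastermind_number n) \<ge> real n - ln (ln (real n))"
proof -
  obtain M where M: "\<And>m. m \<ge> M \<Longrightarrow> 2 * exp (real m + 2) \<le> (fact m :: real)"
    using eventually_exp_le_fact unfolding eventually_sequentially by blast
  \<comment> \<open>The double exponential gives \<open>ln (ln n) \<ge> M + 3\<close>, hence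
    \<open>m \<ge> M\<close> and \<open>m > 0\<close> below.\<close>
  define n0 where "n0 = nat \<lceil>exp (exp (real M + 3))\<rceil>"
  have "(\<forall>\<sigma>. valid_strategy n \<sigma> \<longrightarrow>
        (\<exists>H. H permutes {1..n} \<and>
             (\<forall>t. determined n \<sigma> H t \<longrightarrow> real t \<ge> real n - ln (ln (real n))))) \<and>
     real (mastermind_number n) \<ge> real n - ln (ln (real n))" if n: "n \<ge> n0" for n
  proof -
    have n_ge: "real n \<ge> exp (exp (real M + 3))"
      using n unfolding n0_def by linarith
    then have n_pos: "real n > 0"
      by (meson exp_gt_zero less_le_trans)
    have ln_ge: "ln (real n) \<ge> exp (real M + 3)"
      using n_ge n_pos by (simp add: ln_ge_iff)
    then have ln_pos: "ln (real n) > 0"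
      by (meson exp_gt_zero less_le_trans)
    have lnln_ge: "ln (ln (real n)) \<ge> real M + 3"
      using ln_ge ln_pos by (simp add: ln_ge_iff)
    \<comment> \<open>Keeps the subtraction \<open>n - m - 2\<close> below from being truncated at
      0.\<close>
    have lnln_le: "ln (ln (real n)) \<le> real n - 2"
      using ln_le_minus_one[OF ln_pos] ln_le_minus_one[OF n_pos] by linarith
    \<comment> \<open>Of the resulting bounds, \<open>ln (ln n) \<le> m + 2\<close> yields the
      factorial condition and \<open>m + 1 \<le> ln (ln n)\<close> the number of guesses.\<close>
    define m where "m = nat \<lfloor>ln (ln (real n))\<rfloor> - 1"
    have m: "m \<ge> M" "m > 0" "real m + 1 \<le> ln (ln (real n))" "ln (ln (real n)) \<le> real m + 2"
      using lnln_ge unfolding m_def by linarith+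
    have "ln (real n) \<le> exp (real m + 2)"
      using m(4) ln_pos by (metis exp_le_cancel_iff exp_ln)
    with M[OF m(1)] have fact_m: "2 * ln (real n) \<le> fact m"
      by linarith
    have ex: "\<exists>H. H permutes {1..n} \<and>
        (\<forall>t. determined n \<sigma> H t \<longrightarrow> real t \<ge> real n - ln (ln (real n)))"
      if valid: "valid_strategy n \<sigma>" for \<sigma>
    proof -
      define T where "T = n - m - 2"
      have "T + m + 2 \<le> n"
        using m(3) lnln_le unfolding T_def by linarith
      then obtain H where H: "H permutes {1..n}" "\<forall>s\<le>T. \<not> determined n \<sigma> H s"
        using ex_undetermined[OF valid m(2) _ fact_m] by blast
      \<comment> \<open>The first round left is \<open>T + 1 = n - m - 1\<close>.\<close>
      moreover have "real t \<ge> real n - ln (ln (real n))" if "t > T" for t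
        using that m(3) unfolding T_def by linarith
      ultimately show ?thesis
        by (meson not_le)
    qed
    \<comment> \<open>The minimum is attained, so the bound for single strategies applies to an
      optimal one.\<close>
    have "\<exists>\<sigma>. valid_strategy n \<sigma> \<and> determines_within n \<sigma> (mastermind_number n)"
      unfolding mastermind_number_def by (rule LeastI_ex) (rule ex_determines_within)
    then obtain \<sigma> where \<sigma>: "valid_strategy n \<sigma>" "determines_within n \<sigma> (mastermind_number n)"
      by blast
    obtain H where H: "H permutes {1..n}"
        "\<forall>t. determined n \<sigma> H t \<longrightarrow> real t \<ge> real n - ln (ln (real n))"
      using ex[OF \<sigma>(1)] by blast
    obtain t where "t \<le> mastermind_number n" "determined n \<sigma> H t"
      using \<sigma>(2) H(1) unfolding determines_within_def by blast
    then have "real (mastermind_number n) \<ge> real n - ln (ln (real n))"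
      using H(2) by (meson of_nat_le_iff order_trans)
    with ex show ?thesis
      by blast
  qed
  then show ?thesis
    by blast
qed

end
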